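(* Let $q$ be an odd prime power, let $k=q^2+1$, let $t$ be a primitive element of $\mathbb{F}_{q^2}$, and let $u \in \langle t \rangle$ with $u \neq \pm 1$. Let $G_u$ be the graph, and $V = \{0\infty\} \cup P \cup Q \cup R$ the partition of its vertex-set, defined in the context. If this partition is equitable with intersection matrix (parts taken in the order $\{0\infty\}, P, Q, R$) $$M = \begin{pmatrix} 0 & 1 & 0 & 0 \\ k-2 & 0 & 1 & 2 \\ 0 & 2 & 2 & 4 \\ 0 & k-5 & k-5 & k-8 \end{pmatrix},$$ then $q = 3$.
   Context: Let $K = \mathbb{F}_{q^2} \cup \{\infty\} = \langle t\rangle \cup \{0,\infty\}$ be the set of points of the projective line $PG(1,q^2)$, where $t$ is a primitive element of $\mathbb{F}_{q^2}$, so $\langle t\rangle = \mathbb{F}_{q^2}^{*}$ is cyclic of order $q^2-1 = k-2$. $K^{(2)}$ denotes the set of unordered pairs of distinct elements of $K$; the pair $\{a,b\}$ is written $ab$. Cross-ratio: for $a,b,c,d \in K$ with $a \ne b$ and $c \neq d$, $$(ab|cd) = \frac{(a-c)(b-d)}{(a-d)(b-c)} \in K,$$ with the usual conventions: if $a,b,c,d$ are distinct and one of them is $\infty$, the two factors containing $\infty$ are cancelled (with the appropriate sign, i.e. the value is the limiting one); the value is $0$ if $a=c$ or $b=d$, and $\infty$ if $a=d$ or $b=c$. Swapping $a,b$ or swapping $c,d$ replaces the cross-ratio by its inverse, so for unordered pairs $ab$, $cd$ the unordered set of values $\{\rho,\rho^{-1}\}$ is well defined. Graph $G_u$: for $u \in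 \langle t\rangle$ with $u \ne \pm 1$, $G_u$ is the simple graph with vertex-set $V = K^{(2)}$ in which $ab$ and $cd$ are adjacent if and only if $(ab|cd) = u$ or $(ab|cd) = u^{-1}$. Partition: put $O_0 = \{0x \mid x \in \langle t\rangle\} \cup \{\infty x \mid x \in \langle t \rangle\}$ and, for $v \in \langle t\rangle$ with $v \ne 1$, let $O_v$ be the set of pairs $\{vx, x\}$ with $x \in \langle t \rangle$; then $O_v = O_{v^{-1}}$, and the sets $\{0\infty\}$, $O_0$ and the distinct $O_v$ partition $V$. Set $$P = O_u, \qquad Q = O_0, \qquad R = \bigcup_{v \in \langle t\rangle,\ v \neq 1, u, u^{-1}} O_v .$$ Equitable partition: a partition $V = V_1 \cup \cdots \cup V_m$ of the vertex-set of a graph is equitable with intersection matrix $M$ if, for all $i,j$, every vertex in $V_j$ has exactly $M_{ij}$ neighbours in $V_i$ (so columns are indexed by the part containing the vertex, rows by the part containing its neighbours; e.g. the entry $2$ in row $P$, column $R$ says each vertex in $R$ has exactly $2$ neighbours in $P$). *)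

theory Defs
  imports
    "HOL-Library.Cardinality"
    "HOL-Library.Disjoint_Sets"
    "HOL-Number_Theory.Prime_Powers"
    "Graph_Theory.Pair_Digraph"
    "Jordan_Normal_Form.Matrix"
begin

section \<open>The projective line and the cross-ratio\<close>

datatype 'a proj_line = Pt 'a | Infty

lemma UNIV_proj_line: "(UNIV :: 'a proj_line set) = insert Infty (range Pt)"
proof -
  have "x \<in> insert Infty (range Pt)" for x :: "'a proj_line"
    by (cases x) auto
  then show ?thesis by auto
qed

instance proj_line :: (finite) finite
  by standard (simp add: UNIV_proj_line)

definition unordered_pairs :: "'b set \<Rightarrow> 'b set set" where
  "unordered_pairs S = {{a, b} | a b. a \<in> S \<and> b \<in> S \<and> a \<noteq> b}"

text \<open>
  The cross-ratio \<open>(a b | c d)\<close> is only meaningful for \<open>a \<noteq> b\<close> and \<open>c \<noteq> d\<close>. After the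
  degenerate cases at most one argument is then the point at infinity, and the value is the limit
  of \<open>(a - c) * (b - d) / ((a - d) * (b - c))\<close>; the sign of the limiting factor is always \<open>+1\<close>.
\<close>

definition cross_ratio ::
  "'a::field proj_line \<Rightarrow> 'a proj_line \<Rightarrow> 'a proj_line \<Rightarrow> 'a proj_line \<Rightarrow> 'a proj_line" where
  "cross_ratio a b c d =
    (if a = c \<or> b = d then Pt 0
     else if a = d \<or> b = c then Infty
     else case (a, b, c, d) of
       (Pt a, Pt b, Pt c, Pt d) \<Rightarrow> Pt (((a - c) * (b - d)) / ((a - d) * (b - c)))
     | (Infty, Pt b, Pt c, Pt d) \<Rightarrow> Pt ((b - d) / (b - c))
     | (Pt a, Infty, Pt c, Pt d) \<Rightarrow> Pt ((a - c) / (a - d))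
     | (Pt a, Pt b, Infty, Pt d) \<Rightarrow> Pt ((b - d) / (a - d))
     | (Pt a, Pt b, Pt c, Infty) \<Rightarrow> Pt ((a - c) / (b - c))
     | _ \<Rightarrow> undefined)"

section \<open>The graph\<close>

text \<open>
  The vertices are the unordered pairs of points, and each edge is represented by its two arcs.
  Adjacency of \<open>X\<close> and \<open>Y\<close> asks for some orderings of the two pairs; other orderings only
  replace the cross-ratio by its inverse.
\<close>

definition cross_ratio_graph :: "'a::field \<Rightarrow> 'a proj_line set pair_pre_digraph" where
  "cross_ratio_graph u =
    \<lparr> pverts = unordered_pairs UNIV,
      parcs = {(X, Y). \<exists>a b c d. X = {a, b} \<and> Y = {c, d} \<and> a \<noteq> b \<and> c \<noteq> d \<and>
                 (cross_ratio a b c d = Pt u \<or> cross_ratio a b c d = Pt (inverse u))} \<rparr>"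

section \<open>The partition of the vertices\<close>

definition cyclic :: "'a::field \<Rightarrow> 'a set" where
  "cyclic t = range (\<lambda>i::int. t powi i)"

definition primitive_element :: "'a::field \<Rightarrow> bool" where
  "primitive_element t \<longleftrightarrow> cyclic t = UNIV - {0}"

definition O_zero :: "'a::field \<Rightarrow> 'a proj_line set set" where
  "O_zero t = {{Pt 0, Pt x} | x. x \<in> cyclic t} \<union> {{Infty, Pt x} | x. x \<in> cyclic t}"

definition O_ratio :: "'a::field \<Rightarrow> 'a \<Rightarrow> 'a proj_line set set" where
  "O_ratio t v = {{Pt (v * x), Pt x} | x. x \<in> cyclic t}"

definition part_P :: "'a::field \<Rightarrow> 'a \<Rightarrow> 'a proj_line set set" where
  "part_P t u = O_ratio t u"

definition part_Q :: "'a::field \<Rightarrow> 'a proj_line set set" where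
  "part_Q t = O_zero t"

definition part_R :: "'a::field \<Rightarrow> 'a \<Rightarrow> 'a proj_line set set" where
  "part_R t u = (\<Union>v \<in> cyclic t - {1, u, inverse u}. O_ratio t v)"

section \<open>Equitable partitions\<close>

text \<open>
  Columns of the intersection matrix are indexed by the part containing the vertex, rows by the
  part containing its neighbours.
\<close>

definition equitable_partition ::
  "'v pair_pre_digraph \<Rightarrow> 'v set list \<Rightarrow> int mat \<Rightarrow> bool" where
  "equitable_partition G Vs M \<longleftrightarrow>
     partition_on (pverts G) (set Vs) \<and> distinct Vs \<and>
     M \<in> carrier_mat (length Vs) (length Vs) \<and>
     (\<forall>i < length Vs. \<forall>j < length Vs. \<forall>v \<in> Vs ! j.
        int (card {w \<in> Vs ! i. (v, w) \<in> parcs G}) = M $$ (i, j))"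

section \<open>Consistency of the definitions\<close>

fun proj_inverse :: "'a::field proj_line \<Rightarrow> 'a proj_line" where
  "proj_inverse Infty = Pt 0"
| "proj_inverse (Pt x) = (if x = 0 then Infty else Pt (inverse x))"

lemma cross_ratio_swap_left:
  "a \<noteq> b \<Longrightarrow> c \<noteq> d \<Longrightarrow> cross_ratio b a c d = proj_inverse (cross_ratio a b c d)"
  by (cases a; cases b; cases c; cases d) (auto simp: cross_ratio_def mult.commute)

lemma cross_ratio_swap_right:
  "a \<noteq> b \<Longrightarrow> c \<noteq> d \<Longrightarrow> cross_ratio a b d c = proj_inverse (cross_ratio a b c d)"
  by (cases a; cases b; cases c; cases d) (auto simp: cross_ratio_def mult.commute)

lemma cross_ratio_swap_pairs:
  "a \<noteq> b \<Longrightarrow> c \<noteq> d \<Longrightarrow> cross_ratio c d a b = cross_ratio a b c d"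
proof -
  have sgn: "(c' - a') * (d' - b') / ((c' - b') * (d' - a')) = (a' - c') * (b' - d') / ((a' - d') * (b' - c'))"
    "(a' - b') / (c' - d') = (b' - a') / (d' - c')" for a' b' c' d' :: 'a
  proof -
    have "(c' - a') * (d' - b') = (a' - c') * (b' - d')"
      "(c' - b') * (d' - a') = (a' - d') * (b' - c')" by (simp_all add: algebra_simps)
    then show "(c' - a') * (d' - b') / ((c' - b') * (d' - a')) = (a' - c') * (b' - d') / ((a' - d') * (b' - c'))"
      by simp
    show "(a' - b') / (c' - d') = (b' - a') / (d' - c')"
      by (metis minus_diff_eq minus_divide_divide)
  qed
  assume "a \<noteq> b" "c \<noteq> d"
  then show ?thesis
    by (cases a; cases b; cases c; cases d) (auto simp: cross_ratio_def sgn(1) intro: sgn(2))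
qed

lemma adjacent_iff:
  assumes "u \<noteq> 0" "a \<noteq> b" "c \<noteq> d"
  shows "({a, b}, {c, d}) \<in> parcs (cross_ratio_graph u) \<longleftrightarrow>
    cross_ratio a b c d = Pt u \<or> cross_ratio a b c d = Pt (inverse u)"
proof -
  have inv: "proj_inverse z = Pt u \<or> proj_inverse z = Pt (inverse u) \<longleftrightarrow>
      z = Pt u \<or> z = Pt (inverse u)" for z
    using assms(1) by (cases z) auto
  have l: "cross_ratio b a c d = proj_inverse (cross_ratio a b c d)"
    and r: "cross_ratio a b d c = proj_inverse (cross_ratio a b c d)"
    and lr: "cross_ratio b a d c = proj_inverse (proj_inverse (cross_ratio a b c d))"
    using assms by (metis cross_ratio_swap_left cross_ratio_swap_right)+
  show ?thesis (is "?L \<longleftrightarrow> ?R")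
  proof
    assume ?L
    then obtain a' b' c' d' where *: "{a, b} = {a', b'}" "{c, d} = {c', d'}"
      "cross_ratio a' b' c' d' = Pt u \<or> cross_ratio a' b' c' d' = Pt (inverse u)"
      by (auto simp: cross_ratio_graph_def)
    then consider "a' = a" "b' = b" "c' = c" "d' = d" | "a' = b" "b' = a" "c' = c" "d' = d"
      | "a' = a" "b' = b" "c' = d" "d' = c" | "a' = b" "b' = a" "c' = d" "d' = c"
      by (auto simp: doubleton_eq_iff)
    then show ?R using *(3) by cases (use l r lr inv in metis)+
  qed (use assms in \<open>auto simp: cross_ratio_graph_def\<close>)
qed

lemma pair_graph_cross_ratio_graph:
  fixes u :: "'a::{finite, field}"
  assumes "u \<noteq> 0"
  shows "pair_graph (cross_ratio_graph u)"
proof -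
  let ?G = "cross_ratio_graph u"
  have ends: "\<exists>a b c d. e = ({a, b}, {c, d}) \<and> a \<noteq> b \<and> c \<noteq> d" if "e \<in> parcs ?G" for e
    using that by (auto simp: cross_ratio_graph_def)
  have wf: "fst e \<in> pverts ?G" "snd e \<in> pverts ?G" if "e \<in> parcs ?G" for e
    using ends[OF that] by (auto simp: cross_ratio_graph_def unordered_pairs_def; blast)+
  have loopfree: "fst e \<noteq> snd e" if e: "e \<in> parcs ?G" for e
  proof
    assume "fst e = snd e"
    then obtain a b where "e = ({a, b}, {a, b})" "a \<noteq> b"
      using ends[OF e] by auto
    with e have "cross_ratio a b a b = Pt u \<or> cross_ratio a b a b = Pt (inverse u)"
      using adjacent_iff[OF assms, of a b a b] by simp
    with assms show False by (simp add: cross_ratio_def)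
  qed
  have sym: "(Y, X) \<in> parcs ?G" if XY: "(X, Y) \<in> parcs ?G" for X Y
  proof -
    obtain a b c d where *: "X = {a, b}" "Y = {c, d}" "a \<noteq> b" "c \<noteq> d"
      using ends[OF XY] by blast
    with XY show ?thesis
      using adjacent_iff[OF assms *(3,4)] adjacent_iff[OF assms *(4,3)]
        cross_ratio_swap_pairs[OF *(3,4)] by simp
  qed
  show ?thesis
  proof unfold_locales
    show "symmetric (with_proj ?G)" unfolding symmetric_def
      by (rule symI) (use sym in simp)
  qed (use wf loopfree in auto)
qed

lemma O_ratio_inverse:
  assumes "primitive_element t" "v \<noteq> 0"
  shows "O_ratio t (inverse v) = O_ratio t v"
proof -
  have "O_ratio t (inverse w) \<subseteq> O_ratio t w" if "w \<noteq> 0" for w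
  proof
    fix X assume "X \<in> O_ratio t (inverse w)"
    then obtain x where x: "x \<noteq> 0" "X = {Pt (inverse w * x), Pt x}"
      using assms(1) by (auto simp: O_ratio_def primitive_element_def)
    have "w * (inverse w * x) = x" using that by (simp flip: mult.assoc)
    with x(2) have "X = {Pt (w * (inverse w * x)), Pt (inverse w * x)}"
      by (simp only: insert_commute)
    moreover have "inverse w * x \<in> cyclic t"
      using that x(1) assms(1) by (simp add: primitive_element_def)
    ultimately show "X \<in> O_ratio t w" unfolding O_ratio_def by blast
  qed
  from this[of v] this[of "inverse v"] assms(2) show ?thesis by auto
qed

lemma O_ratio_iff:
  assumes "primitive_element t" "v \<noteq> 0"
  shows "X \<in> O_ratio t v \<longleftrightarrow> (\<exists>x y. x \<noteq> 0 \<and> y \<noteq> 0 \<and> X = {Pt x, Pt y} \<and> x / y = v)"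
proof
  have cyc: "cyclic t = UNIV - {0}" using assms(1) by (simp add: primitive_element_def)
  show "\<exists>x y. x \<noteq> 0 \<and> y \<noteq> 0 \<and> X = {Pt x, Pt y} \<and> x / y = v" if "X \<in> O_ratio t v"
  proof -
    from that obtain x where "x \<noteq> 0" "X = {Pt (v * x), Pt x}"
      by (auto simp: O_ratio_def cyc)
    then show ?thesis using assms(2) by (intro exI[of _ "v * x"] exI[of _ x]) simp
  qed
  show "X \<in> O_ratio t v" if "\<exists>x y. x \<noteq> 0 \<and> y \<noteq> 0 \<and> X = {Pt x, Pt y} \<and> x / y = v"
  proof -
    from that obtain x y where "y \<noteq> 0" "X = {Pt x, Pt y}" "x = v * y" by auto
    then show ?thesis by (auto simp: O_ratio_def cyc)
  qed
qed

lemma partition_parts: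
  fixes t u :: "'a::{finite, field}"
  assumes t: "primitive_element t" and u: "u \<in> cyclic t" "u \<noteq> 1"
    and card: "CARD('a) > 4"
  defines "Vs \<equiv> [{{Pt 0, Infty}}, part_P t u, part_Q t, part_R t u]"
  shows "partition_on (unordered_pairs UNIV) (set Vs)" "distinct Vs"
proof -
  have cyc: "cyclic t = UNIV - {0}" using t by (simp add: primitive_element_def)
  have u0: "u \<noteq> 0" using u cyc by auto
  have P: "X \<in> part_P t u \<longleftrightarrow>
      (\<exists>x y. x \<noteq> 0 \<and> y \<noteq> 0 \<and> X = {Pt x, Pt y} \<and> x / y = u)" for X
    using O_ratio_iff[OF t u0] by (simp add: part_P_def)
  have R: "X \<in> part_R t u \<longleftrightarrow> (\<exists>x y. x \<noteq> 0 \<and> y \<noteq> 0 \<and> x \<noteq> y \<and> X = {Pt x, Pt y} \<and>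
      x / y \<noteq> u \<and> x / y \<noteq> inverse u)" for X
  proof -
    have "X \<in> part_R t u \<longleftrightarrow> (\<exists>v. v \<noteq> 0 \<and> v \<noteq> 1 \<and> v \<noteq> u \<and> v \<noteq> inverse u \<and> X \<in> O_ratio t v)"
      by (auto simp: part_R_def cyc)
    also have "\<dots> \<longleftrightarrow> (\<exists>v. v \<noteq> 0 \<and> v \<noteq> 1 \<and> v \<noteq> u \<and> v \<noteq> inverse u \<and>
        (\<exists>x y. x \<noteq> 0 \<and> y \<noteq> 0 \<and> X = {Pt x, Pt y} \<and> x / y = v))"
      using O_ratio_iff[OF t] by metis
    also have "\<dots> \<longleftrightarrow> (\<exists>x y. x \<noteq> 0 \<and> y \<noteq> 0 \<and> x \<noteq> y \<and> X = {Pt x, Pt y} \<and>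
        x / y \<noteq> u \<and> x / y \<noteq> inverse u)"
      (is "?L \<longleftrightarrow> ?R")
    proof
      assume ?L
      then obtain x y where "x \<noteq> 0" "y \<noteq> 0" "X = {Pt x, Pt y}"
        "x / y \<noteq> 1" "x / y \<noteq> u" "x / y \<noteq> inverse u" by blast
      then show ?R by (intro exI[of _ x] exI[of _ y]) auto
    next
      assume ?R
      then obtain x y where "x \<noteq> 0" "y \<noteq> 0" "x \<noteq> y" "X = {Pt x, Pt y}"
        "x / y \<noteq> u" "x / y \<noteq> inverse u" by blast
      then show ?L by (intro exI[of _ "x / y"] conjI exI[of _ x] exI[of _ y]) simp_all
    qed
    finally show ?thesis .
  qed
  have Q: "X \<in> part_Q t \<longleftrightarrow> (\<exists>x. x \<noteq> 0 \<and> (X = {Pt 0, Pt x} \<or> X = {Infty, Pt x}))" for X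
    by (auto simp: part_Q_def O_zero_def cyc)
  have ne: "part_P t u \<noteq> {}" "part_Q t \<noteq> {}" "part_R t u \<noteq> {}"
  proof -
    show "part_P t u \<noteq> {}" using P[of "{Pt u, Pt 1}"] u0 by (metis div_by_1 empty_iff zero_neq_one)
    show "part_Q t \<noteq> {}" using Q[of "{Pt 0, Pt 1}"] by (metis empty_iff zero_neq_one)
    have "card {0, 1, u, inverse u} \<le> 4" by (simp add: card_insert_if)
    then have "{0, 1, u, inverse u} \<noteq> UNIV" using card by auto
    then obtain v where "v \<noteq> 0" "v \<noteq> 1" "v \<noteq> u" "v \<noteq> inverse u" by auto
    then show "part_R t u \<noteq> {}" using R[of "{Pt v, Pt 1}"] by (metis div_by_1 empty_iff zero_neq_one)
  qed
  have disj: "{{Pt 0, Infty}} \<inter> part_P t u = {}" "{{Pt 0, Infty}} \<inter> part_Q t = {}"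
    "{{Pt 0, Infty}} \<inter> part_R t u = {}" "part_P t u \<inter> part_Q t = {}"
    "part_P t u \<inter> part_R t u = {}" "part_Q t \<inter> part_R t u = {}"
    by (auto simp: P Q R doubleton_eq_iff)
  have "\<Union>(set Vs) = unordered_pairs UNIV"
  proof (intro equalityI subsetI)
    fix X assume "X \<in> \<Union>(set Vs)"
    then consider "X = {Pt 0, Infty}" | "X \<in> part_P t u" | "X \<in> part_Q t" | "X \<in> part_R t u"
      by (auto simp: Vs_def)
    then have "\<exists>a b. X = {a, b} \<and> a \<noteq> b"
    proof cases
      case 1
      then show ?thesis by blast
    next
      case 2
      then obtain x y where "y \<noteq> 0" "X = {Pt x, Pt y}" "x / y = u" unfolding P by blast
      then show ?thesis using u(2) by (intro exI[of _ "Pt x"] exI[of _ "Pt y"]) auto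
    next
      case 3
      then obtain x where "x \<noteq> 0" "X = {Pt 0, Pt x} \<or> X = {Infty, Pt x}" unfolding Q by blast
      then show ?thesis by (metis proj_line.distinct(2) proj_line.inject)
    next
      case 4
      then obtain x y where "x \<noteq> y" "X = {Pt x, Pt y}" unfolding R by blast
      then show ?thesis by blast
    qed
    then show "X \<in> unordered_pairs UNIV" by (auto simp: unordered_pairs_def)
  next
    fix X :: "'a proj_line set" assume "X \<in> unordered_pairs UNIV"
    then obtain a b where X: "X = {a, b}" "a \<noteq> b" by (auto simp: unordered_pairs_def)
    have fin: "{Pt x, Pt y} \<in> \<Union>(set Vs)" if "x \<noteq> y" for x y
    proof (cases "x = 0 \<or> y = 0")
      case True
      then have "{Pt x, Pt y} \<in> part_Q t"
        using that by (cases "x = 0") (auto simp: Q doubleton_eq_iff)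
      then show ?thesis by (simp add: Vs_def)
    next
      case False
      show ?thesis
      proof (cases "x / y = u \<or> x / y = inverse u")
        case True
        then have "x / y = u \<or> y / x = u" by (metis inverse_divide inverse_inverse_eq)
        moreover have "{Pt x, Pt y} = {Pt y, Pt x}" by (rule insert_commute)
        ultimately have "{Pt x, Pt y} \<in> part_P t u"
          unfolding P using False by blast
        then show ?thesis by (simp add: Vs_def)
      next
        case neq: False
        then have "{Pt x, Pt y} \<in> part_R t u"
          unfolding R using False that by blast
        then show ?thesis by (simp add: Vs_def)
      qed
    qed
    have inf: "{Infty, Pt x} \<in> \<Union>(set Vs)" for x
      by (cases "x = 0") (auto simp: Vs_def Q insert_commute)
    show "X \<in> \<Union>(set Vs)"
      using X fin inf by (cases a; cases b) (auto simp: insert_commute)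
  qed
  moreover have "disjoint (set Vs)" unfolding Vs_def using disj by (auto simp: disjoint_def)
  ultimately show "partition_on (unordered_pairs UNIV) (set Vs)"
    using ne by (auto simp: partition_on_def Vs_def)
  have neq: "A \<noteq> B" if "A \<inter> B = {}" "B \<noteq> {}" for A B :: "'a proj_line set set"
    using that by blast
  show "distinct Vs"
    unfolding Vs_def using neq[OF disj(1) ne(1)] neq[OF disj(2) ne(2)] neq[OF disj(3) ne(3)]
      neq[OF disj(4) ne(2)] neq[OF disj(5) ne(3)] neq[OF disj(6) ne(3)]
    by simp
qed

end

theory Submission
  imports Defs "HOL-Number_Theory.Residues"
begin

text \<open>
  By scaling, the neighbours in \<open>P\<close> of the pair \<open>{v, 1}\<close> correspond to the roots of the two
  quadratics \<open>u y\<^sup>2 - v (1 + u) y + v\<close> and \<open>u y\<^sup>2 - (1 + u) y + v\<close>, which have no common root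
  when \<open>v \<noteq> 1\<close>. So these have two roots in total for \<open>v \<notin> {0, 1, u, u\<inverse>}\<close> and none for
  \<open>v = u\<close>. The choice \<open>v = (1 + u)\<^sup>2 / (4 u)\<close> makes the second discriminant vanish, hence the first
  one as well, which forces \<open>(1 + u)\<^sup>2 = - 4 u\<close>. The discriminants then are \<open>(1 + u)\<^sup>2 v (1 + v)\<close> and
  \<open>(1 + u)\<^sup>2 (1 + v)\<close>; if \<open>v\<close> is a square they have the same number of square roots, which must
  be one, so \<open>v = -1\<close>. Hence the nonzero squares all lie in \<open>{1, -1, u, u\<inverse>}\<close>, and there
  are \<open>(q\<^sup>2 - 1) / 2\<close> of them.
\<close>

text \<open>Completing the square: as \<open>2 * a\<close> is invertible,
  \<open>y \<mapsto> 2 * a * y + b\<close> carries the roots bijectively onto the square roots of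
  the discriminant.\<close>

lemma card_quadratic_roots:
  fixes a b c :: "'a::{finite, field}"
  assumes "(2::'a) \<noteq> 0" "a \<noteq> 0"
  shows "card {y. a * y\<^sup>2 + b * y + c = 0} = card {r. r\<^sup>2 = b\<^sup>2 - 4 * a * c}"
proof -
  have complete: "(2 * a * y + b)\<^sup>2 = b\<^sup>2 - 4 * a * c \<longleftrightarrow> a * y\<^sup>2 + b * y + c = 0" for y
  proof -
    have "(2 * a * y + b)\<^sup>2 - (b\<^sup>2 - 4 * a * c) = 2 * 2 * a * (a * y\<^sup>2 + b * y + c)"
      by (simp add: power2_eq_square algebra_simps)
    then show ?thesis using assms by (metis eq_iff_diff_eq_0 mult_eq_0_iff)
  qed
  have "bij_betw (\<lambda>y. 2 * a * y + b) {y. a * y\<^sup>2 + b * y + c = 0} {r. r\<^sup>2 = b\<^sup>2 - 4 * a * c}"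
  proof (rule bij_betwI[where g = "\<lambda>r. (r - b) / (2 * a)"])
    show "(\<lambda>y. 2 * a * y + b) \<in> {y. a * y\<^sup>2 + b * y + c = 0} \<rightarrow> {r. r\<^sup>2 = b\<^sup>2 - 4 * a * c}"
      using complete by auto
    have inv: "2 * a * ((r - b) / (2 * a)) + b = r" for r
      using assms by simp
    show "(\<lambda>r. (r - b) / (2 * a)) \<in> {r. r\<^sup>2 = b\<^sup>2 - 4 * a * c} \<rightarrow> {y. a * y\<^sup>2 + b * y + c = 0}"
    proof
      fix r assume "r \<in> {r. r\<^sup>2 = b\<^sup>2 - 4 * a * c}"
      then show "(r - b) / (2 * a) \<in> {y. a * y\<^sup>2 + b * y + c = 0}"
        using complete[of "(r - b) / (2 * a)"] unfolding inv by simp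
    qed
  qed (use assms in auto)
  then show ?thesis by (rule bij_betw_same_card)
qed

text \<open>Square roots come in pairs \<open>r\<close>, \<open>- r\<close>, and these coincide only
  for \<open>r = 0\<close> when \<open>2\<close> is nonzero.\<close>

lemma card_sqrts_eq_1D:
  fixes d :: "'a::{finite, field}"
  assumes "(2::'a) \<noteq> 0" "card {r. r\<^sup>2 = d} = 1"
  shows "d = 0"
proof -
  obtain r where r: "{r. r\<^sup>2 = d} = {r}"
    using assms(2) by (auto simp: card_1_singleton_iff)
  then have "r\<^sup>2 = d" by auto
  then have "- r \<in> {r. r\<^sup>2 = d}" by simp
  then have "- r = r" using r by blast
  then have "2 * r = 0" by (metis add.right_inverse mult_2)
  with assms(1) \<open>r\<^sup>2 = d\<close> show ?thesis by simp
qed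

lemma card_sqrts_mult_square:
  fixes d w :: "'a::field"
  assumes "w \<noteq> 0"
  shows "card {r. r\<^sup>2 = w\<^sup>2 * d} = card {r. r\<^sup>2 = d}"
proof -
  have "bij_betw (\<lambda>r. w * r) {r. r\<^sup>2 = d} {r. r\<^sup>2 = w\<^sup>2 * d}"
    by (rule bij_betwI[where g = "\<lambda>r. r / w"]) (use assms in \<open>auto simp: power_mult_distrib power_divide\<close>)
  then show ?thesis by (simp add: bij_betw_same_card)
qed

text \<open>Squaring is at most two-to-one; the summand \<open>1\<close> accounts for the element
  \<open>0\<close>.\<close>

lemma card_field_le_squares:
  fixes S :: "'a::{finite, field} set"
  assumes "\<And>w. w \<noteq> 0 \<Longrightarrow> w\<^sup>2 \<in> S"
  shows "CARD('a) \<le> 2 * card S + 1"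
proof -
  have fibre: "card {w. w\<^sup>2 = s} \<le> 2" for s :: 'a
  proof (cases "\<exists>r. r\<^sup>2 = s")
    case True
    then obtain r where "r\<^sup>2 = s" by blast
    then have "{w. w\<^sup>2 = s} \<subseteq> {r, - r}" by (auto simp: power2_eq_iff)
    then have "card {w. w\<^sup>2 = s} \<le> card {r, - r}" by (intro card_mono) auto
    also have "\<dots> \<le> 2" by (simp add: card_insert_if)
    finally show ?thesis .
  qed simp
  have "UNIV - {0} \<subseteq> (\<Union>s\<in>S. {w. w\<^sup>2 = s})" using assms by auto
  then have "card (UNIV - {0::'a}) \<le> card (\<Union>s\<in>S. {w. w\<^sup>2 = s})" by (intro card_mono) auto
  also have "\<dots> \<le> (\<Sum>s\<in>S. card {w. w\<^sup>2 = s})" by (rule card_UN_le) simp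
  also have "\<dots> \<le> (\<Sum>s\<in>S. 2)" by (intro sum_mono fibre)
  finally show ?thesis by (simp add: card_Diff_singleton)
qed

lemma adjacent_ratio_iff:
  fixes u v y :: "'a::field"
  assumes "u \<noteq> 0" "u \<noteq> 1" "v \<noteq> 0" "v \<noteq> 1" "y \<noteq> 0"
  shows "({Pt v, Pt 1}, {Pt (u * y), Pt y}) \<in> parcs (cross_ratio_graph u) \<longleftrightarrow>
    u * y\<^sup>2 - v * (1 + u) * y + v = 0 \<or> u * y\<^sup>2 - (1 + u) * y + v = 0"
proof -
  let ?A = "(v - u * y) * (1 - y)" and ?B = "(v - y) * (1 - u * y)"
  \<comment> \<open>The cross-ratio is \<open>?A / ?B\<close>. Equating it to \<open>u\<close> or
    \<open>inverse u\<close> and clearing denominators leaves, up to sign, the factor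
    \<open>1 - u\<close>, which cancels.\<close>
  have "?A - u * ?B = (1 - u) * (u * y\<^sup>2 - v * (1 + u) * y + v)"
    by (simp add: power2_eq_square algebra_simps)
  then have first: "?A = u * ?B \<longleftrightarrow> u * y\<^sup>2 - v * (1 + u) * y + v = 0"
    using assms(2) by (metis eq_iff_diff_eq_0 mult_eq_0_iff)
  have "u * ?A - ?B = (u - 1) * (u * y\<^sup>2 - (1 + u) * y + v)"
    by (simp add: power2_eq_square algebra_simps)
  then have second: "u * ?A = ?B \<longleftrightarrow> u * y\<^sup>2 - (1 + u) * y + v = 0"
    using assms(2) by (metis eq_iff_diff_eq_0 mult_eq_0_iff)
  have ne: "u * y \<noteq> y" using assms by simp
  with assms(4) have "({Pt v, Pt 1}, {Pt (u * y), Pt y}) \<in> parcs (cross_ratio_graph u) \<longleftrightarrow>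
      cross_ratio (Pt v) (Pt 1) (Pt (u * y)) (Pt y) = Pt u \<or>
      cross_ratio (Pt v) (Pt 1) (Pt (u * y)) (Pt y) = Pt (inverse u)"
    using adjacent_iff[OF assms(1), of "Pt v" "Pt 1" "Pt (u * y)" "Pt y"] by simp
  also have "\<dots> \<longleftrightarrow> ?A = u * ?B \<or> u * ?A = ?B"
  \<comment> \<open>If \<open>?A\<close> or \<open>?B\<close> vanishes, the cross-ratio is
    \<open>Pt 0\<close> or \<open>Infty\<close>, so there is no adjacency; both equations fail too,
    because \<open>?A\<close> and \<open>?B\<close> never vanish together.\<close>
  proof (cases "v = u * y \<or> 1 = y")
    case True
    then have "?B \<noteq> 0" using assms ne by auto
    then show ?thesis using True assms(1) by (auto simp: cross_ratio_def)
  next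
    case A: False
    show ?thesis
    proof (cases "v = y \<or> 1 = u * y")
      case True
      then show ?thesis using A assms(1) by (auto simp: cross_ratio_def)
    next
      case False
      then have "?B \<noteq> 0" by simp
      with A False have "cross_ratio (Pt v) (Pt 1) (Pt (u * y)) (Pt y) = Pt (?A / ?B)"
        by (auto simp: cross_ratio_def)
      with \<open>?B \<noteq> 0\<close> assms(1) show ?thesis by (auto simp: field_simps)
    qed
  qed
  finally show ?thesis using first second by simp
qed

text \<open>Each pair in \<open>part_P t u\<close> has the form \<open>{Pt (u * y), Pt y}\<close>
  for a unique nonzero \<open>y\<close>, so neighbours are counted by roots of the two quadratics,
  and these by square roots of their discriminants.\<close>

lemma card_neighbours_part_P:
  fixes t u v :: "'a::{finite, field}"
  assumes "(2::'a) \<noteq> 0" "primitive_element t"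
    and u: "u \<noteq> 0" "u \<noteq> 1" "u \<noteq> - 1" and v: "v \<noteq> 0" "v \<noteq> 1"
  shows "card {w \<in> part_P t u. ({Pt v, Pt 1}, w) \<in> parcs (cross_ratio_graph u)} =
    card {r. r\<^sup>2 = v * (v * (1 + u)\<^sup>2 - 4 * u)} + card {r. r\<^sup>2 = (1 + u)\<^sup>2 - 4 * u * v}"
proof -
  define A where "A = {y. u * y\<^sup>2 + (- (v * (1 + u))) * y + v = 0}"
  define B where "B = {y. u * y\<^sup>2 + (- (1 + u)) * y + v = 0}"
  let ?f = "\<lambda>y. {Pt (u * y), Pt y}"
  have nz: "y \<noteq> 0" if "y \<in> A \<union> B" for y
    using that v by (auto simp: A_def B_def)
  have "1 + u \<noteq> 0" using u(3) by (metis add_eq_0_iff)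
  have "A \<inter> B = {}"
  proof (rule ccontr)
    assume "A \<inter> B \<noteq> {}"
    then obtain y where y: "y \<in> A" "y \<in> B" by blast
    \<comment> \<open>The difference of the two equations: the quadratic and constant terms
      cancel.\<close>
    then have "(1 - v) * (1 + u) * y = 0"
      by (simp add: A_def B_def algebra_simps)
    with v nz[of y] y \<open>1 + u \<noteq> 0\<close> show False by auto
  qed
  have "{w \<in> part_P t u. ({Pt v, Pt 1}, w) \<in> parcs (cross_ratio_graph u)} = ?f ` (A \<union> B)"
  proof -
    have "{w \<in> part_P t u. ({Pt v, Pt 1}, w) \<in> parcs (cross_ratio_graph u)} =
        ?f ` {y. y \<noteq> 0 \<and> ({Pt v, Pt 1}, ?f y) \<in> parcs (cross_ratio_graph u)}"
    proof -
      have "part_P t u = ?f ` {y. y \<noteq> 0}"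
        using assms(2) unfolding part_P_def O_ratio_def primitive_element_def by blast
      then show ?thesis by (simp only: Compr_image_eq mem_Collect_eq)
    qed
    also have "{y. y \<noteq> 0 \<and> ({Pt v, Pt 1}, ?f y) \<in> parcs (cross_ratio_graph u)} = A \<union> B"
    proof (rule Set.set_eqI)
      fix y
      show "y \<in> {y. y \<noteq> 0 \<and> ({Pt v, Pt 1}, ?f y) \<in> parcs (cross_ratio_graph u)} \<longleftrightarrow> y \<in> A \<union> B"
      proof (cases "y = 0")
        case True
        then show ?thesis using nz[of y] by blast
      next
        case False
        then show ?thesis
          unfolding mem_Collect_eq adjacent_ratio_iff[OF u(1,2) v False]
          by (simp add: A_def B_def del: minus_add_distrib)
      qed
    qed
    finally show ?thesis .
  qed
  moreover have "inj_on ?f (A \<union> B)"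
  proof (rule inj_onI)
    fix x y assume xy: "x \<in> A \<union> B" "y \<in> A \<union> B" "?f x = ?f y"
    show "x = y"
    proof (rule ccontr)
      assume "x \<noteq> y"
      \<comment> \<open>Equal pairs with distinct parameters must match crosswise, which forces
        \<open>u * u = 1\<close>.\<close>
      with xy(3) have "u * x = y" "u * y = x" by (auto simp: doubleton_eq_iff)
      then have "(u * u - 1) * x = 0" by (simp add: algebra_simps)
      then have "u * u = 1" using nz[OF xy(1)] by simp
      with u show False by (simp add: square_eq_1_iff)
    qed
  qed
  ultimately have "card {w \<in> part_P t u. ({Pt v, Pt 1}, w) \<in> parcs (cross_ratio_graph u)} =
      card A + card B"
    using \<open>A \<inter> B = {}\<close> by (simp add: card_image card_Un_disjoint)
  moreover have "card A = card {r. r\<^sup>2 = v * (v * (1 + u)\<^sup>2 - 4 * u)}"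
    unfolding A_def card_quadratic_roots[OF assms(1) u(1)]
    by (simp add: power2_eq_square algebra_simps)
  moreover have "card B = card {r. r\<^sup>2 = (1 + u)\<^sup>2 - 4 * u * v}"
    unfolding B_def card_quadratic_roots[OF assms(1) u(1)]
    by (simp add: power2_eq_square algebra_simps)
  ultimately show ?thesis by simp
qed

theorem theorem3:
  fixes q k :: nat and t u :: "'a::{finite, field}"
  assumes "primepow q" and "odd q" and "k = q\<^sup>2 + 1"
    and "CARD('a) = q\<^sup>2"
    and "primitive_element t"
    and "u \<in> cyclic t" and "u \<noteq> 1" and "u \<noteq> - 1"
    and "equitable_partition (cross_ratio_graph u)
           [{{Pt 0, Infty}}, part_P t u, part_Q t, part_R t u]
           (mat_of_rows_list 4
             [[0, 1, 0, 0],
              [int k - 2, 0, 1, 2],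
              [0, 2, 2, 4],
              [0, int k - 5, int k - 5, int k - 8]])"
  shows "q = 3"
proof -
  have cyc: "cyclic t = UNIV - {0}" using assms(5) by (simp add: primitive_element_def)
  have u: "u \<noteq> 0" "u \<noteq> 1" "u \<noteq> - 1" using assms(6-8) cyc by auto
  have s: "1 + u \<noteq> 0" using u(3) by (metis add_eq_0_iff)
  \<comment> \<open>In characteristic 2 the order of the field would be even, but it is the odd
    number \<open>q\<^sup>2\<close>.\<close>
  have two: "(2::'a) \<noteq> 0"
  proof
    assume "(2::'a) = 0"
    then have "CHAR('a) dvd 2" by (metis of_nat_eq_0_iff_char_dvd of_nat_numeral)
    then have "CHAR('a) = 2" by (metis CHAR_not_1' One_nat_def prime_nat_iff two_is_prime_nat)
    then have "even (q\<^sup>2)" using CHAR_dvd_CARD[where ?'a = 'a] assms(4) by simp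
    with assms(2) show False by simp
  qed
  then have four: "(4::'a) \<noteq> 0" by (metis mult_2 mult_eq_0_iff numeral_Bit0)
  define a where "a = (1 + u)\<^sup>2 / (4 * u)"
  have a: "(1 + u)\<^sup>2 = 4 * u * a" using u(1) four by (simp add: a_def)
  define N where "N = (\<lambda>d::'a. card {r. r\<^sup>2 = d})"
  have N0: "N 0 = 1" by (simp add: N_def)
  have nbrs: "card {w \<in> part_P t u. ({Pt v, Pt 1}, w) \<in> parcs (cross_ratio_graph u)} =
      N (v * (v * (1 + u)\<^sup>2 - 4 * u)) + N ((1 + u)\<^sup>2 - 4 * u * v)" if "v \<noteq> 0" "v \<noteq> 1" for v
    using card_neighbours_part_P[OF two assms(5) u that] by (simp add: N_def)
  have entries: "\<forall>i<4. \<forall>j<4. \<forall>v \<in> [{{Pt 0, Infty}}, part_P t u, part_Q t, part_R t u] ! j.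
      int (card {w \<in> [{{Pt 0, Infty}}, part_P t u, part_Q t, part_R t u] ! i.
        (v, w) \<in> parcs (cross_ratio_graph u)}) =
      mat_of_rows_list 4 [[0, 1, 0, 0], [int k - 2, 0, 1, 2], [0, 2, 2, 4],
        [0, int k - 5, int k - 5, int k - 8]] $$ (i, j)"
    using assms(9) by (simp add: equitable_partition_def)
  have mem: "{Pt v, Pt 1} \<in> O_ratio t v" for v
    unfolding O_ratio_def cyc by (intro CollectI exI[of _ 1]) simp
  have PR: "N (v * (v * (1 + u)\<^sup>2 - 4 * u)) + N ((1 + u)\<^sup>2 - 4 * u * v) = 2"
    if v: "v \<notin> {0, 1, u, inverse u}" for v
  proof -
    have "{Pt v, Pt 1} \<in> part_R t u"
      unfolding part_R_def cyc by (rule UN_I[where a = v]) (use v mem in simp_all)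
    then have "card {w \<in> part_P t u. ({Pt v, Pt 1}, w) \<in> parcs (cross_ratio_graph u)} = 2"
      \<comment> \<open>Counting from zero, row 1 is the part P and column 3 the part R.\<close>
      using entries[rule_format, of 1 3 "{Pt v, Pt 1}"] by (simp add: mat_of_rows_list_def)
    then show ?thesis using nbrs[of v] v by simp
  qed
  have PP: "N (u * (u * (1 + u)\<^sup>2 - 4 * u)) + N ((1 + u)\<^sup>2 - 4 * u * u) = 0"
  proof -
    have "{Pt u, Pt 1} \<in> part_P t u"
      unfolding part_P_def by (rule mem)
    then have "card {w \<in> part_P t u. ({Pt u, Pt 1}, w) \<in> parcs (cross_ratio_graph u)} = 0"
      using entries[rule_format, of 1 1 "{Pt u, Pt 1}"] by (simp add: mat_of_rows_list_def)
    then show ?thesis using nbrs[OF u(1,2)] by simp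
  qed
  have a_ne: "a \<noteq> 1"
  proof
    assume "a = 1"
    then have "(u - 1)\<^sup>2 = 0" using a by (simp add: power2_eq_square algebra_simps)
    with u(2) show False by simp
  qed
  \<comment> \<open>For \<open>a = u\<close> the second discriminant in \<open>PP\<close> would be
    zero, for \<open>a = inverse u\<close> the first; a zero discriminant contributes 1 to a sum
    that is 0.\<close>
  have "a \<notin> {0, 1, u, inverse u}"
  proof -
    have "a \<noteq> 0" using s u(1) four by (simp add: a_def)
    moreover have "a \<noteq> u" using PP a N0 by auto
    moreover have "a \<noteq> inverse u"
    proof
      assume "a = inverse u"
      then have "u * (1 + u)\<^sup>2 - 4 * u = 0" using a u(1) by simp
      with PP N0 show False by simp
    qed
    ultimately show ?thesis using a_ne by simp
  qed
  \<comment> \<open>At \<open>v = a\<close> the second count is \<open>N 0 = 1\<close>, which leaves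
    1 for the first.\<close>
  from PR[OF this] have "N (a * (a * (1 + u)\<^sup>2 - 4 * u)) = 1" using a N0 by simp
  then have "a * (a * (1 + u)\<^sup>2 - 4 * u) = 0"
    unfolding N_def by (rule card_sqrts_eq_1D[OF two])
  then have "a * (4 * u) * (a * a - 1) = 0" using a by (simp add: algebra_simps)
  then have "a * a = 1" using \<open>a \<notin> {0, 1, u, inverse u}\<close> u(1) four by simp
  then have "a = - 1" using a_ne by (simp add: square_eq_1_iff)
  with a have u4: "4 * u = - ((1 + u)\<^sup>2)" by simp
  have "w\<^sup>2 \<in> {1, - 1, u, inverse u}" if w: "w \<noteq> 0" for w
  proof (rule ccontr)
    assume w2: "w\<^sup>2 \<notin> {1, - 1, u, inverse u}"
    have d1: "w\<^sup>2 * (w\<^sup>2 * (1 + u)\<^sup>2 - 4 * u) = w\<^sup>2 * ((1 + u)\<^sup>2 * (1 + w\<^sup>2))"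
      and d2: "(1 + u)\<^sup>2 - 4 * u * w\<^sup>2 = (1 + u)\<^sup>2 * (1 + w\<^sup>2)"
      unfolding u4 by (simp_all add: algebra_simps)
    \<comment> \<open>The square factor does not affect the count, so the two counts in
      \<open>PR\<close> agree and each is half of 2.\<close>
    have "N (w\<^sup>2 * ((1 + u)\<^sup>2 * (1 + w\<^sup>2))) = N ((1 + u)\<^sup>2 * (1 + w\<^sup>2))"
      unfolding N_def by (rule card_sqrts_mult_square[OF w])
    with PR[of "w\<^sup>2"] w w2 d1 d2 have "N ((1 + u)\<^sup>2 * (1 + w\<^sup>2)) = 1" by simp
    then have "(1 + u)\<^sup>2 * (1 + w\<^sup>2) = 0"
      unfolding N_def by (rule card_sqrts_eq_1D[OF two])
    then have "w\<^sup>2 = - 1" using s by (simp add: add_eq_0_iff)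
    with w2 show False by simp
  qed
  then have "q\<^sup>2 \<le> 2 * card {1, - 1, u, inverse u} + 1"
    using card_field_le_squares assms(4) by metis
  \<comment> \<open>The set has at most four elements, and \<open>2 * 4 + 1 = 9\<close>.\<close>
  also have "\<dots> \<le> 3\<^sup>2" by (simp add: card_insert_if)
  finally have "q \<le> 3" by (rule power2_le_imp_le) simp
  moreover have "q > 1" using primepow_gt_Suc_0[OF assms(1)] by simp
  ultimately show "q = 3" using assms(2) by (cases "q = 2") auto
qed

end
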